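(* Let $\lambda>0$, $-\infty<\mu<\infty$ and $\alpha=-\frac12-i\mu$. Then for $-\infty<x<0$, $$\frac1\pi\int_0^\infty\frac{t^{\alpha/2}J_\alpha(\lambda\sqrt t)\,dt}{t-x}=\frac{(-x)^{\alpha/2}}{\cosh\pi\mu}\left[I_\alpha(\lambda\sqrt{-x})-I_{-\alpha}(\lambda\sqrt{-x})\right].$$
   Context: $J_\alpha$ is the Bessel function of the first kind and $I_\alpha$ is the modified Bessel function of the first kind (both of complex order). Powers of positive numbers are principal. *)

theory Defs
  imports "HOL-Analysis.Analysis"
begin

text \<open>
  Bessel function of the first kind and modified Bessel function of the first kind, of complex
  order, on the principal branch, for nonzero argument. Since \<open>rGamma\<close> is the entire
  function \<open>1 / Gamma\<close>, no order has to be excluded. At \<open>z = 0\<close> the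
  convention \<open>0 powr \<alpha> = 0\<close> makes both functions \<open>0\<close>, which is not the
  usual value for \<open>\<alpha> = 0\<close>.
\<close>

definition Bessel_J :: "complex \<Rightarrow> complex \<Rightarrow> complex" where
  "Bessel_J \<alpha> z =
     (z / 2) powr \<alpha> * (\<Sum>k. (-1) ^ k * rGamma (\<alpha> + of_nat k + 1) / fact k * (z / 2) ^ (2 * k))"

definition Bessel_I :: "complex \<Rightarrow> complex \<Rightarrow> complex" where
  "Bessel_I \<alpha> z =
     (z / 2) powr \<alpha> * (\<Sum>k. rGamma (\<alpha> + of_nat k + 1) / fact k * (z / 2) ^ (2 * k))"

end

(*
  With C_\<alpha>(z) = sum_k z^k / (k! \<Gamma>(\<alpha>+k+1)), the entire factor of the Bessel functions, scaling
  reduces the claim to the Stieltjes transform of t^\<alpha> C_\<alpha>(-t). Since Re \<alpha> = -1/2, the function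
  C_\<alpha>(-t) is bounded, so the integral converges absolutely and 1/(t+y) may be written as a Laplace
  integral; the Laplace transform of t^\<alpha> C_\<alpha>(-t) is s^(-\<alpha>-1) exp(-1/s), which turns the
  Stieltjes transform into Macdonald's integral. The latter solves the same second order equation
  as C_\<alpha>(y) and y^(-\<alpha>) C_(-\<alpha>)(y); the three Wronskians are constant and are read off at y = 0,
  which expresses it through these two.
*)
theory Submission
  imports Defs
begin

text \<open>All integrals are moved to the real line by t = exp p. There measurability mostly
  follows from continuity, each scaling of t is a translation of p, and each inversion t -> y / t a
  reflection. The line Re \<alpha> = - 1 / 2 enters three times. It makes an energy of
  C_\<alpha>(-r) conserved, whence the bound on that function; as t^\<alpha> has modulus t^(-1/2),
  the integrand is then dominated by a multiple of t^(-1/2) / (t + y). It gives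
  \<open>- \<alpha>\<close> and \<open>\<alpha> + 1\<close> the same real part 1/2, so both
  Macdonald integrals are continuous down to y = 0 and are Gamma values there. It is invariant under
  \<alpha> -> - \<alpha> - 1, which swaps the two integrals and so yields the second Wronskian from
  the first. Differentiation lowers the order of a Macdonald integral out of the half plane Re > 0;
  the symmetry in the sign of the order brings it back, so the two integrals form a closed first
  order system. The cosh of the result is - sin(pi \<alpha>), from the reflection formula behind the
  third Wronskian.\<close>

section \<open>The Bessel-Clifford function: series, differential equation, bound\<close>

definition bessel_clifford :: "complex \<Rightarrow> complex \<Rightarrow> complex" where
  "bessel_clifford \<nu> z = (\<Sum>k. rGamma (\<nu> + of_nat k + 1) / fact k * z ^ k)"

text \<open>Ratio test: beyond |\<nu>| + 2 |z| the factor \<nu> + n + 1 has modulus at least 1, so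
  the \<open>rGamma\<close> values do not grow in modulus, while |z| / (n + 1) is at most
  1/2.\<close>

lemma summable_bessel_clifford: "summable (\<lambda>k. rGamma (\<nu> + of_nat k + 1) / fact k * z ^ k)"
proof -
  obtain N where N: "real N > norm \<nu> + 2 * norm z"
    using reals_Archimedean2 by blast
  show ?thesis
  proof (rule summable_ratio_test)
    show "(1 / 2 :: real) < 1" by simp
    fix n assume n: "N \<le> n"
    have "real n + 1 - norm \<nu> \<le> norm (\<nu> + of_nat n + 1)"
      using norm_triangle_ineq4[of "\<nu> + of_nat n + 1" \<nu>]
      by (simp add: algebra_simps) (metis norm_of_nat of_nat_Suc)
    hence one: "1 \<le> norm (\<nu> + of_nat n + 1)" and z: "2 * norm z \<le> real (Suc n)"
      using N n norm_ge_zero[of z] norm_ge_zero[of \<nu>] by linarith+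
    have "norm (rGamma (\<nu> + of_nat (Suc n) + 1)) * 1
        \<le> norm (rGamma (\<nu> + of_nat (Suc n) + 1)) * norm (\<nu> + of_nat n + 1)"
      by (intro mult_left_mono one) auto
    also have "\<dots> = norm (rGamma (\<nu> + of_nat n + 1))"
      using rGamma_plus1[of "\<nu> + of_nat n + 1"] by (simp flip: norm_mult add: ac_simps)
    finally have g: "norm (rGamma (\<nu> + of_nat (Suc n) + 1)) \<le> norm (rGamma (\<nu> + of_nat n + 1))"
      by simp
    have zn: "norm z / real (Suc n) \<le> 1 / 2"
      using z by (simp add: field_simps)
    have "norm (rGamma (\<nu> + of_nat (Suc n) + 1) / fact (Suc n) * z ^ Suc n)
        = norm (rGamma (\<nu> + of_nat (Suc n) + 1)) * (norm z / real (Suc n)) * (norm z ^ n / fact n)"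
      by (simp add: norm_mult norm_divide norm_power del: of_nat_Suc)
    also have "\<dots> \<le> norm (rGamma (\<nu> + of_nat n + 1)) * (1 / 2) * (norm z ^ n / fact n)"
      by (intro mult_mono g zn) auto
    also have "\<dots> = 1 / 2 * norm (rGamma (\<nu> + of_nat n + 1) / fact n * z ^ n)"
      by (simp add: norm_mult norm_divide norm_power)
    finally show "norm (rGamma (\<nu> + of_nat (Suc n) + 1) / fact (Suc n) * z ^ Suc n)
        \<le> 1 / 2 * norm (rGamma (\<nu> + of_nat n + 1) / fact n * z ^ n)" .
  qed
qed

lemma bessel_clifford_0: "bessel_clifford \<nu> 0 = rGamma (\<nu> + 1)"
  unfolding bessel_clifford_def by (subst powser_zero) simp

lemma has_field_derivative_bessel_clifford:
  "(bessel_clifford \<nu> has_field_derivative bessel_clifford (\<nu> + 1) z) (at z within A)"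
proof -
  let ?c = "\<lambda>k. rGamma (\<nu> + of_nat k + 1) / fact k"
  have "((\<lambda>z. \<Sum>k. ?c k * z ^ k) has_field_derivative (\<Sum>k. diffs ?c k * z ^ k)) (at z)"
    by (rule termdiffs_strong_converges_everywhere) (rule summable_bessel_clifford)
  moreover have "diffs ?c k = rGamma ((\<nu> + 1) + of_nat k + 1) / fact k" for k
  proof -
    have "\<nu> + of_nat (Suc k) + 1 = (\<nu> + 1) + of_nat k + 1" by simp
    moreover have "1 + complex_of_nat k \<noteq> 0" by (metis of_nat_Suc of_nat_neq_0)
    ultimately show ?thesis unfolding diffs_def by simp
  qed
  ultimately show ?thesis
    by (simp add: bessel_clifford_def[abs_def] has_field_derivative_at_within)
qed

text \<open>As differentiation raises the order by one, this is the differential equation z v'' +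
  (\<nu> + 1) v' = v. Coefficientwise it is the functional equation of \<open>rGamma\<close> at
  \<nu> + k + 1.\<close>

lemma bessel_clifford_recurrence:
  "z * bessel_clifford (\<nu> + 2) z + (\<nu> + 1) * bessel_clifford (\<nu> + 1) z = bessel_clifford \<nu> z"
proof -
  let ?b = "\<lambda>\<nu> k. rGamma (\<nu> + of_nat k + 1) / fact k * z ^ k"
  have "(\<lambda>k. z * ?b (\<nu> + 2) k) sums (z * bessel_clifford (\<nu> + 2) z)"
    unfolding bessel_clifford_def by (intro sums_mult summable_sums summable_bessel_clifford)
  moreover have "z * ?b (\<nu> + 2) k = of_nat (Suc k) * ?b (\<nu> + 1) (Suc k)" for k
  proof -
    have "(\<nu> + 1) + of_nat (Suc k) + 1 = (\<nu> + 2) + of_nat k + 1" by simp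
    moreover have "1 + complex_of_nat k \<noteq> 0" by (metis of_nat_Suc of_nat_neq_0)
    ultimately show ?thesis by simp
  qed
  ultimately have "(\<lambda>k. of_nat (Suc k) * ?b (\<nu> + 1) (Suc k)) sums (z * bessel_clifford (\<nu> + 2) z)"
    by simp
  \<comment> \<open>The factor \<open>of_nat k\<close> annihilates the term k = 0, so prepending it
    leaves the sum unchanged.\<close>
  from this[THEN sums_Suc]
  have "(\<lambda>k. of_nat k * ?b (\<nu> + 1) k) sums (z * bessel_clifford (\<nu> + 2) z)" by simp
  moreover have "(\<lambda>k. (\<nu> + 1) * ?b (\<nu> + 1) k) sums ((\<nu> + 1) * bessel_clifford (\<nu> + 1) z)"
    unfolding bessel_clifford_def by (intro sums_mult summable_sums summable_bessel_clifford)
  ultimately have "(\<lambda>k. of_nat k * ?b (\<nu> + 1) k + (\<nu> + 1) * ?b (\<nu> + 1) k) sums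
      (z * bessel_clifford (\<nu> + 2) z + (\<nu> + 1) * bessel_clifford (\<nu> + 1) z)"
    by (rule sums_add)
  moreover have "of_nat k * ?b (\<nu> + 1) k + (\<nu> + 1) * ?b (\<nu> + 1) k = ?b \<nu> k" for k
  proof -
    have "of_nat k * ?b (\<nu> + 1) k + (\<nu> + 1) * ?b (\<nu> + 1) k
       = (\<nu> + of_nat k + 1) * rGamma ((\<nu> + of_nat k + 1) + 1) / fact k * z ^ k"
      by (simp add: algebra_simps add_divide_distrib)
    thus ?thesis by (simp only: rGamma_plus1)
  qed
  ultimately have "?b \<nu> sums
      (z * bessel_clifford (\<nu> + 2) z + (\<nu> + 1) * bessel_clifford (\<nu> + 1) z)" by simp
  thus ?thesis unfolding bessel_clifford_def by (rule sums_unique)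
qed

lemma continuous_on_bessel_clifford [continuous_intros]:
  assumes "continuous_on A g"
  shows "continuous_on A (\<lambda>x. bessel_clifford \<nu> (g x))"
proof -
  have "continuous_on UNIV (bessel_clifford \<nu>)"
    by (rule DERIV_continuous_on) (rule has_field_derivative_bessel_clifford)
  from continuous_on_compose2[OF this assms] show ?thesis by simp
qed

text \<open>
  For \<open>Re \<nu> = - 1 / 2\<close> the energy
  \<open>\<bar>C\<^sub>\<nu> (- r)\<bar>\<^sup>2 + r \<bar>C\<^sub>\<nu>\<^sub>+\<^sub>1 (- r)\<bar>\<^sup>2\<close> is conserved.
\<close>
lemma norm_bessel_clifford_minus_le:
  assumes \<nu>: "Re \<nu> = - 1 / 2" and r: "0 \<le> r"
  shows "norm (bessel_clifford \<nu> (- of_real r)) \<le> norm (rGamma (\<nu> + 1))"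
proof -
  define f where "f = (\<lambda>r::real. bessel_clifford \<nu> (- of_real r))"
  define g where "g = (\<lambda>r::real. bessel_clifford (\<nu> + 1) (- of_real r))"
  define h where "h = (\<lambda>r::real. bessel_clifford (\<nu> + 2) (- of_real r))"
  have minus: "((\<lambda>r. - complex_of_real r) has_vector_derivative - 1) (at r)" for r
    by (auto intro!: derivative_eq_intros)
  have df: "(f has_vector_derivative - g r) (at r)" for r
    using field_vector_diff_chain_at[OF minus has_field_derivative_bessel_clifford]
    by (simp add: f_def g_def o_def)
  have dg: "(g has_vector_derivative - h r) (at r)" for r
    using field_vector_diff_chain_at[OF minus has_field_derivative_bessel_clifford[of "\<nu> + 1"]]
    by (simp add: g_def h_def o_def add.assoc)
  have D': "((\<lambda>r. Re (f r)) has_real_derivative - Re (g r)) (at r)"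
    "((\<lambda>r. Im (f r)) has_real_derivative - Im (g r)) (at r)"
    "((\<lambda>r. Re (g r)) has_real_derivative - Re (h r)) (at r)"
    "((\<lambda>r. Im (g r)) has_real_derivative - Im (h r)) (at r)" for r
    using has_field_derivative_Re[OF df[of r]] has_field_derivative_Im[OF df[of r]]
      has_field_derivative_Re[OF dg[of r]] has_field_derivative_Im[OF dg[of r]] by simp_all
  define e where "e = (\<lambda>r. (Re (f r))\<^sup>2 + (Im (f r))\<^sup>2 + r * ((Re (g r))\<^sup>2 + (Im (g r))\<^sup>2))"
  have "(e has_real_derivative 0) (at r)" for r
  proof -
    have "- of_real r * h r + (\<nu> + 1) * g r = f r"
      unfolding f_def g_def h_def by (rule bessel_clifford_recurrence)
    hence "r * Re (h r) = Re ((\<nu> + 1) * g r - f r)" "r * Im (h r) = Im ((\<nu> + 1) * g r - f r)"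
      by (auto simp: complex_eq_iff)
    \<comment> \<open>Re (\<nu> + 1) = 1/2 produces the halves of \<open>g r\<close> that cancel the
      square of |g| arising from the weight r; the terms with \<open>Im \<nu>\<close> cancel each
      other.\<close>
    hence h: "r * Re (h r) = Re (g r) / 2 - Im \<nu> * Im (g r) - Re (f r)"
      "r * Im (h r) = Im (g r) / 2 + Im \<nu> * Re (g r) - Im (f r)"
      using \<nu> by (simp_all)
    have "(e has_real_derivative (2 * Re (f r) * (- Re (g r)) + 2 * Im (f r) * (- Im (g r))
        + ((Re (g r))\<^sup>2 + (Im (g r))\<^sup>2 + r * (2 * Re (g r) * (- Re (h r)) + 2 * Im (g r) * (- Im (h r))))))
        (at r)"
      unfolding e_def by (rule derivative_eq_intros D' refl | simp)+
    also have "2 * Re (f r) * (- Re (g r)) + 2 * Im (f r) * (- Im (g r))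
        + ((Re (g r))\<^sup>2 + (Im (g r))\<^sup>2 + r * (2 * Re (g r) * (- Re (h r)) + 2 * Im (g r) * (- Im (h r))))
      = - 2 * Re (f r) * Re (g r) - 2 * Im (f r) * Im (g r) + (Re (g r))\<^sup>2 + (Im (g r))\<^sup>2
        - 2 * Re (g r) * (r * Re (h r)) - 2 * Im (g r) * (r * Im (h r))"
      by (simp add: algebra_simps)
    also have "\<dots> = 0"
      unfolding h by (simp add: algebra_simps power2_eq_square)
    finally show ?thesis .
  qed
  hence "e r = e 0"
    using DERIV_isconst_all by blast
  hence "(norm (f r))\<^sup>2 + r * (norm (g r))\<^sup>2 = (norm (f 0))\<^sup>2"
    by (simp add: e_def cmod_power2)
  hence "(norm (f r))\<^sup>2 \<le> (norm (f 0))\<^sup>2"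
    using r by (metis add.commute add_increasing2 mult_nonneg_nonneg order_refl zero_le_power2 le_add_same_cancel1)
  hence "norm (f r) \<le> norm (f 0)"
    by (rule power2_le_imp_le) simp
  thus ?thesis
    by (simp add: f_def bessel_clifford_0)
qed

section \<open>Substitution t = exp p and Euler's integral\<close>

text \<open>Measurability is asked of the pulled-back integrand, which is easy to check; it returns
  to \<open>f\<close> on t > 0 through \<open>ln\<close>. The change of variables theorem concerns
  the completed measure, hence the detour through \<open>lebesgue\<close>.\<close>

lemma
  fixes f :: "real \<Rightarrow> 'a :: euclidean_space"
  assumes meas: "(\<lambda>p. exp p *\<^sub>R f (exp p)) \<in> borel_measurable borel"
  shows set_integrable_exp_substitution:
      "set_integrable lborel {0<..} f \<longleftrightarrow> integrable lborel (\<lambda>p. exp p *\<^sub>R f (exp p))"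
    and set_integral_exp_substitution:
      "set_integrable lborel {0<..} f \<Longrightarrow>
        (LBINT t:{0<..}. f t) = (LBINT p. exp p *\<^sub>R f (exp p))"
proof -
  define h where "h = (\<lambda>p. exp p *\<^sub>R f (exp p))"
  have [measurable]: "h \<in> borel_measurable borel"
    using meas by (simp add: h_def)
  have "(\<lambda>t. indicator {0<..} t *\<^sub>R f t) = (\<lambda>t. indicator {0<..} t *\<^sub>R ((1 / t) *\<^sub>R h (ln t)))"
    by (auto simp: h_def fun_eq_iff indicator_def)
  hence m: "(\<lambda>t. indicator {0<..} t *\<^sub>R f t) \<in> borel_measurable lborel"
    by simp
  have set_eq: "set_integrable lebesgue {0<..} f \<longleftrightarrow> set_integrable lborel {0<..} f"
    unfolding set_integrable_def by (rule integrable_completion[OF m])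
  have h_eq: "set_integrable lebesgue UNIV h \<longleftrightarrow> integrable lborel h"
    unfolding set_integrable_def by (subst integrable_completion) auto
  have im: "exp ` (UNIV :: real set) = {0<..}"
    by (auto simp: image_iff) (metis exp_ln)
  have d: "(exp has_field_derivative exp x) (at x within UNIV)" for x :: real
    by (rule DERIV_exp)
  have cov: "h absolutely_integrable_on UNIV \<and> integral UNIV h = b
      \<longleftrightarrow> f absolutely_integrable_on {0<..} \<and> integral {0<..} f = b" for b
    using has_absolute_integral_change_of_variables_real[OF _ d, of f b]
    by (simp add: im h_def inj_on_def)
  thus iff: "set_integrable lborel {0<..} f \<longleftrightarrow> integrable lborel (\<lambda>p. exp p *\<^sub>R f (exp p))"
    using set_eq h_eq unfolding h_def by metis
  assume "set_integrable lborel {0<..} f"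
  hence f: "f absolutely_integrable_on {0<..}" and h: "h absolutely_integrable_on UNIV"
    using set_eq h_eq iff by (auto simp: h_def)
  have "(LBINT t:{0<..}. f t) = (LINT t:{0<..}|lebesgue. f t)"
    unfolding set_lebesgue_integral_def by (rule integral_completion[OF m, symmetric])
  also have "\<dots> = integral {0<..} f"
    by (rule set_lebesgue_integral_eq_integral(2)[OF f])
  also have "\<dots> = integral UNIV h"
    using cov h by blast
  also have "\<dots> = (LINT t:UNIV|lebesgue. h t)"
    by (rule set_lebesgue_integral_eq_integral(2)[OF h, symmetric])
  also have "\<dots> = (LBINT p. h p)"
    unfolding set_lebesgue_integral_def by (subst integral_completion) auto
  finally show "(LBINT t:{0<..}. f t) = (LBINT p. exp p *\<^sub>R f (exp p))"
    by (simp add: h_def)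
qed

lemma of_real_powr_eq_exp: "0 < t \<Longrightarrow> of_real t powr z = exp (z * of_real (ln t))" for z :: complex
  by (simp add: powr_def Ln_of_real)

text \<open>Euler's integral: t^(z - 1) exp(-t) dt becomes exp(z p - exp p) dp.\<close>

lemma
  fixes z :: complex
  assumes z: "0 < Re z"
  shows integrable_Gamma_exp: "integrable lborel (\<lambda>p. exp (z * of_real p - of_real (exp p)))"
    and Gamma_exp_integral: "(LBINT p. exp (z * of_real p - of_real (exp p))) = Gamma z"
proof -
  let ?f = "\<lambda>t. complex_of_real t powr (z - 1) / of_real (exp t)"
  let ?h = "\<lambda>p. exp (z * of_real p - of_real (exp p)) :: complex"
  have eq: "exp p *\<^sub>R ?f (exp p) = ?h p" for p
    by (simp add: of_real_powr_eq_exp exp_diff scaleR_conv_of_real exp_of_real algebra_simps)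
  have m: "(\<lambda>p. exp p *\<^sub>R ?f (exp p)) \<in> borel_measurable borel"
    unfolding eq by (intro borel_measurable_continuous_onI continuous_intros)
  have meas: "(\<lambda>t. indicator {0<..} t *\<^sub>R ?f t) \<in> borel_measurable lborel"
  proof -
    have "(\<lambda>t. indicator {0<..} t *\<^sub>R ?f t)
        = (\<lambda>t. indicator {0<..} t *\<^sub>R (exp ((z - 1) * of_real (ln t)) / of_real (exp t)))"
      by (auto simp: fun_eq_iff of_real_powr_eq_exp indicator_def)
    thus ?thesis by simp
  qed
  have ai: "?f absolutely_integrable_on {0<..}"
    by (rule absolutely_integrable_Gamma_integral'[OF z])
  hence si: "set_integrable lborel {0<..} ?f"
    unfolding set_integrable_def by (simp only: integrable_completion[OF meas])
  thus "integrable lborel ?h"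
    using set_integrable_exp_substitution[OF m] by (simp only: eq)
  have "(LBINT p. ?h p) = (LBINT t:{0<..}. ?f t)"
    using set_integral_exp_substitution[OF m si] by (simp only: eq)
  also have "\<dots> = (LINT t:{0<..}|lebesgue. ?f t)"
    unfolding set_lebesgue_integral_def by (rule integral_completion[OF meas, symmetric])
  also have "\<dots> = integral {0<..} ?f"
    by (rule set_lebesgue_integral_eq_integral(2)[OF ai])
  also have "\<dots> = Gamma z"
    by (rule integral_unique[OF Gamma_integral_complex'[OF z]])
  finally show "(LBINT p. ?h p) = Gamma z" .
qed

section \<open>Macdonald's integral: continuity, symmetry, derivative\<close>

text \<open>
  In terms of the Macdonald function this is \<open>2 y\<^sup>\<beta>\<^sup>/\<^sup>2 K\<^sub>\<beta> (2 \<surd>y)\<close>;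
  the usual integrand over \<open>t > 0\<close> is pulled back along \<open>t = exp p\<close>.
\<close>
definition macdonald :: "complex \<Rightarrow> real \<Rightarrow> complex" where
  "macdonald \<beta> y = (LBINT p. exp (\<beta> * of_real p - of_real (exp p) - of_real (y * exp (- p))))"

lemma macdonald_0: "0 < Re \<beta> \<Longrightarrow> macdonald \<beta> 0 = Gamma \<beta>"
  by (simp add: macdonald_def Gamma_exp_integral)

lemma borel_measurable_macdonald [measurable]:
  "(\<lambda>p. exp (\<beta> * of_real p - of_real (exp p) - of_real (y * exp (- p))) :: complex)
    \<in> borel_measurable borel"
  by (intro borel_measurable_continuous_onI continuous_intros)

lemma integrable_macdonald:
  assumes "0 < Re \<beta>" "0 \<le> y"
  shows "integrable lborel (\<lambda>p. exp (\<beta> * of_real p - of_real (exp p) - of_real (y * exp (- p))))"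
proof (rule Bochner_Integration.integrable_bound[OF integrable_Gamma_exp[OF assms(1)]])
  show "AE p in lborel. norm (exp (\<beta> * of_real p - of_real (exp p) - of_real (y * exp (- p))))
      \<le> norm (exp (\<beta> * of_real p - of_real (exp p)))"
    using assms(2) by (simp add: norm_exp)
qed simp

text \<open>With v = exp(-p) this is y v \<le> exp(y v). It absorbs the factor exp(-p) that d/dy
  brings down, so order \<open>\<beta> - 1\<close>, whose real part may be negative, is still
  dominated by the integrand of \<open>Gamma \<beta>\<close>.\<close>

lemma exp_minus_mult_exp_le:
  fixes p y :: real
  assumes "0 < y"
  shows "exp (- p) * exp (- (y * exp (- p))) \<le> 1 / y"
proof -
  have "y * exp (- p) \<le> exp (y * exp (- p))"
    using exp_ge_add_one_self[of "y * exp (- p)"] by linarith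
  thus ?thesis
    using assms by (simp add: exp_minus field_simps)
qed

lemma integrable_macdonald_shift:
  assumes "0 < Re \<beta>" "0 < y"
  shows "integrable lborel
    (\<lambda>p. exp ((\<beta> - 1) * of_real p - of_real (exp p) - of_real (y * exp (- p))))"
proof (rule Bochner_Integration.integrable_bound)
  show "integrable lborel (\<lambda>p. (1 / y) *\<^sub>R exp (\<beta> * of_real p - of_real (exp p)))"
    by (intro integrable_scaleR_right integrable_Gamma_exp assms)
  have "norm (exp ((\<beta> - 1) * of_real p - of_real (exp p) - of_real (y * exp (- p))))
      = exp (- p) * exp (- (y * exp (- p))) * norm (exp (\<beta> * of_real p - of_real (exp p)))" for p
    by (simp add: norm_exp algebra_simps flip: exp_add)
  hence "norm (exp ((\<beta> - 1) * of_real p - of_real (exp p) - of_real (y * exp (- p))))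
      \<le> 1 / y * norm (exp (\<beta> * of_real p - of_real (exp p)))" for p
    using mult_right_mono[OF exp_minus_mult_exp_le[OF assms(2)] norm_ge_zero] by (simp only:)
  thus "AE p in lborel. norm (exp ((\<beta> - 1) * of_real p - of_real (exp p) - of_real (y * exp (- p))))
      \<le> norm ((1 / y) *\<^sub>R exp (\<beta> * of_real p - of_real (exp p)))"
    using assms(2) by (intro AE_I2) (simp only: norm_scaleR, simp)
qed simp

text \<open>The endpoint 0 is included because the Wronskian constant is evaluated there. The
  integrand at y = 0 dominates all the others.\<close>

lemma continuous_on_macdonald:
  assumes \<beta>: "0 < Re \<beta>"
  shows "continuous_on {0..} (macdonald \<beta>)"
  unfolding continuous_on_sequentially o_def
proof (intro allI ballI impI, elim conjE)
  fix X :: "nat \<Rightarrow> real" and y assume y: "y \<in> {0..}" and X: "\<forall>n. X n \<in> {0..}" "X \<longlonglongrightarrow> y"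
  show "(\<lambda>n. macdonald \<beta> (X n)) \<longlonglongrightarrow> macdonald \<beta> y"
    unfolding macdonald_def
  proof (rule integral_dominated_convergence)
    show "integrable lborel (\<lambda>p. norm (exp (\<beta> * of_real p - of_real (exp p))))"
      by (intro integrable_norm integrable_Gamma_exp \<beta>)
    show "AE p in lborel. (\<lambda>n. exp (\<beta> * of_real p - of_real (exp p) - of_real (X n * exp (- p))))
        \<longlonglongrightarrow> exp (\<beta> * of_real p - of_real (exp p) - of_real (y * exp (- p)))"
      by (intro AE_I2 tendsto_intros X)
    show "AE p in lborel. norm (exp (\<beta> * of_real p - of_real (exp p) - of_real (X n * exp (- p))))
        \<le> norm (exp (\<beta> * of_real p - of_real (exp p)))" for n
      using X(1) by (simp add: norm_exp)
  qed simp_all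
qed

text \<open>The reflection p -> ln y - p exchanges exp p and y exp(-p). This is the symmetry
  K_(-\<beta>) = K_\<beta>.\<close>

lemma macdonald_minus:
  assumes y: "0 < y"
  shows "macdonald (- \<beta>) y = of_real y powr (- \<beta>) * macdonald \<beta> y"
proof -
  have "exp (- \<beta> * of_real (ln y - p) - of_real (exp (ln y - p)) - of_real (y * exp (- (ln y - p))))
    = of_real y powr (- \<beta>) * exp (\<beta> * of_real p - of_real (exp p) - of_real (y * exp (- p)))" for p
    using y by (simp add: of_real_powr_eq_exp exp_diff exp_minus exp_add field_simps flip: exp_add)
  thus ?thesis
    unfolding macdonald_def
    by (subst lborel_integral_real_affine[where c = "-1" and t = "ln y"]) simp_all
qed

lemma has_vector_derivative_macdonald:
  assumes \<beta>: "0 < Re \<beta>" and y: "0 < y"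
  shows "(macdonald \<beta> has_vector_derivative - macdonald (\<beta> - 1) y) (at y)"
proof -
  define G where "G = (\<lambda>p. exp (\<beta> * of_real p - of_real (exp p)))"
  define g where "g = (\<lambda>p y. exp (\<beta> * of_real p - of_real (exp p) - of_real (y * exp (- p))))"
  define g' where "g' = (\<lambda>p. - exp ((\<beta> - 1) * of_real p - of_real (exp p) - of_real (y * exp (- p))))"
  \<comment> \<open>The normalised remainder of the linear approximation in y; that its integral
    tends to 0 is the differentiability claimed, and dominated convergence gives it.\<close>
  define q where "q = (\<lambda>p Y. ((g p Y - g p y) - (Y - y) *\<^sub>R g' p) /\<^sub>R norm (Y - y))"
  have g_eq: "g p u = G p * of_real (exp (- (u * exp (- p))))" for p u
    by (simp add: g_def G_def exp_of_real[symmetric] flip: exp_add)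
  have g'_eq: "g' p = - (G p * of_real (exp (- p) * exp (- (y * exp (- p)))))" for p
    by (simp add: g'_def G_def exp_of_real[symmetric] algebra_simps flip: exp_add)
  have der: "((\<lambda>u. exp (- (u * exp (- p)))) has_real_derivative - (exp (- p) * exp (- (u * exp (- p))))) (at u within S)"
    for p u :: real and S
    by (auto intro!: derivative_eq_intros)
  have at_y: "at y = at y within {y / 2<..}"
    using y by (intro at_within_open[symmetric]) auto
  have [measurable]: "(\<lambda>p. g p u) \<in> borel_measurable borel" for u
    unfolding g_def by measurable
  have [measurable]: "g' \<in> borel_measurable borel"
    unfolding g'_def by measurable
  \<comment> \<open>The constant is 2 / y + 1 / y: the mean value bound over u > y / 2 uses 1 / u <
    2 / y, and the linear term \<open>g'\<close> contributes 1 / y.\<close>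
  have bound: "norm (q p Y) \<le> 3 / y * norm (G p)" if Y: "Y \<in> {y / 2<..} - {y}" for p Y
  proof -
    have "norm (exp (- (Y * exp (- p))) - exp (- (y * exp (- p)))) \<le> 2 / y * norm (Y - y)"
    proof (rule field_differentiable_bound[OF _ der])
      show "convex {y / 2<..}" by simp
      fix u assume u: "u \<in> {y / 2<..}"
      hence "0 < u" using y by auto
      have "exp (- p) * exp (- (u * exp (- p))) \<le> 1 / u"
        by (rule exp_minus_mult_exp_le) fact
      also have "\<dots> \<le> 2 / y" using u y \<open>0 < u\<close> by (simp add: field_simps)
      finally show "norm (- (exp (- p) * exp (- (u * exp (- p))))) \<le> 2 / y" by simp
    qed (use Y y in auto)
    hence "norm (G p) * norm (exp (- (Y * exp (- p))) - exp (- (y * exp (- p))))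
        \<le> norm (G p) * (2 / y * norm (Y - y))"
      by (intro mult_left_mono) auto
    moreover have "norm (g p Y - g p y)
        = norm (G p) * norm (exp (- (Y * exp (- p))) - exp (- (y * exp (- p))))"
      unfolding g_eq by (metis norm_mult norm_of_real of_real_diff real_norm_def right_diff_distrib')
    ultimately have 1: "norm (g p Y - g p y) \<le> 2 / y * norm (G p) * norm (Y - y)"
      by (simp add: mult_ac)
    have "norm (G p) * (exp (- p) * exp (- (y * exp (- p)))) \<le> norm (G p) * (1 / y)"
      by (intro mult_left_mono exp_minus_mult_exp_le y) auto
    hence "norm (g' p) \<le> 1 / y * norm (G p)"
      by (simp add: g'_eq norm_mult mult_ac)
    hence 2: "norm ((Y - y) *\<^sub>R g' p) \<le> 1 / y * norm (G p) * norm (Y - y)"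
      using mult_right_mono[of "norm (g' p)" "1 / y * norm (G p)" "norm (Y - y)"] by (simp add: mult_ac)
    have "norm ((g p Y - g p y) - (Y - y) *\<^sub>R g' p) \<le> 3 / y * norm (G p) * norm (Y - y)"
      using norm_triangle_ineq4[of "g p Y - g p y" "(Y - y) *\<^sub>R g' p"] 1 2
      by (simp add: field_simps)
    moreover have "norm (q p Y) = norm ((g p Y - g p y) - (Y - y) *\<^sub>R g' p) / norm (Y - y)"
      by (simp add: q_def divide_inverse mult_ac)
    moreover have "0 < norm (Y - y)" using Y by simp
    ultimately show ?thesis by (simp only: pos_divide_le_eq)
  qed
  have lim: "((\<lambda>Y. q p Y) \<longlongrightarrow> 0) (at y within {y / 2<..})" for p
  proof -
    have "((\<lambda>u. G p * of_real (exp (- (u * exp (- p))))) has_vector_derivative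
        G p * of_real (- (exp (- p) * exp (- (y * exp (- p)))))) (at y within {y / 2<..})"
      by (intro has_vector_derivative_mult_right has_vector_derivative_of_real der)
    hence "(g p has_vector_derivative g' p) (at y within {y / 2<..})"
      by (simp add: g_eq[abs_def] g'_eq)
    thus ?thesis
      unfolding q_def has_vector_derivative_def has_derivative_at_within by blast
  qed
  have gint: "integrable lborel (\<lambda>p. g p Y)" if "0 < Y" for Y
    unfolding g_def using that \<beta> by (intro integrable_macdonald) auto
  have g'int: "integrable lborel g'"
    unfolding g'_def using \<beta> y by (intro integrable_minus integrable_macdonald_shift) auto
  have q_lim: "((\<lambda>Y. LBINT p. q p Y) \<longlongrightarrow> 0) (at y within {y / 2<..})"
    unfolding tendsto_at_iff_sequentially o_def
  proof (intro allI impI)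
    fix X assume X: "\<forall>i. X i \<in> {y / 2<..} - {y}" "X \<longlonglongrightarrow> y"
    have "(\<lambda>n. LBINT p. q p (X n)) \<longlonglongrightarrow> (LBINT (p :: real). (0 :: complex))"
    proof (rule integral_dominated_convergence)
      show "integrable lborel (\<lambda>p. 3 / y * norm (G p))"
        unfolding G_def by (intro integrable_mult_right integrable_norm integrable_Gamma_exp \<beta>)
      show "AE p in lborel. (\<lambda>n. q p (X n)) \<longlonglongrightarrow> 0"
        using lim X unfolding tendsto_at_iff_sequentially o_def by simp
      show "AE p in lborel. norm (q p (X n)) \<le> 3 / y * norm (G p)" for n
        using bound X(1) by simp
    qed (simp_all add: q_def)
    thus "(\<lambda>n. LBINT p. q p (X n)) \<longlonglongrightarrow> 0" by simp
  qed
  have q_eq: "(LBINT p. q p Y)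
      = ((macdonald \<beta> Y - macdonald \<beta> y) - (Y - y) *\<^sub>R (LBINT p. g' p)) /\<^sub>R norm (Y - y)"
    if "Y \<in> {y / 2<..}" for Y
  proof -
    have "integrable lborel (\<lambda>p. g p Y)" "integrable lborel (\<lambda>p. g p y)"
      using that y by (auto intro!: gint)
    moreover have "macdonald \<beta> Y = (LBINT p. g p Y)" for Y
      by (simp add: macdonald_def g_def)
    ultimately show ?thesis
      using g'int by (simp add: q_def)
  qed
  from q_lim have "((\<lambda>Y. ((macdonald \<beta> Y - macdonald \<beta> y) - (Y - y) *\<^sub>R (LBINT p. g' p)) /\<^sub>R norm (Y - y))
      \<longlongrightarrow> 0) (at y within {y / 2<..})"
    by (rule Lim_transform_eventually) (simp add: eventually_at_filter q_eq)
  hence "(macdonald \<beta> has_vector_derivative (LBINT p. g' p)) (at y within {y / 2<..})"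
    unfolding has_vector_derivative_def has_derivative_at_within
    by (auto intro: bounded_linear_scaleR_left)
  thus ?thesis
    by (simp add: at_y g'_def macdonald_def)
qed

section \<open>Wronskians and the connection formula\<close>

lemma has_vector_derivative_bessel_clifford [derivative_intros]:
  "((\<lambda>y. bessel_clifford \<nu> (of_real y)) has_vector_derivative bessel_clifford (\<nu> + 1) (of_real y))
    (at y within A)"
  using field_vector_diff_chain_within[OF has_vector_derivative_of_real[OF DERIV_ident]
      has_field_derivative_bessel_clifford[of \<nu>]]
  by (simp add: o_def)

lemma has_vector_derivative_of_real_powr:
  assumes "0 < y"
  shows "((\<lambda>y. complex_of_real y powr s) has_vector_derivative s * of_real y powr (s - 1)) (at y within A)"
proof -
  have "complex_of_real y \<notin> \<real>\<^sub>\<le>\<^sub>0"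
    using assms by (auto simp: complex_nonpos_Reals_iff)
  from field_vector_diff_chain_within[OF has_vector_derivative_of_real[OF DERIV_ident]
      has_field_derivative_at_within[OF has_field_derivative_powr[OF this]]]
  show ?thesis by (simp add: o_def)
qed

lemma powr_plus_1: "0 < y \<Longrightarrow> of_real y powr (s + 1) = of_real y * of_real y powr s" for s :: complex
  by (simp add: powr_add)

text \<open>
  The left-hand side is a Wronskian of two solutions of \<open>y v'' + (1 + \<alpha>) v' = v\<close>, hence constant;
  the constant is its limit as \<open>y\<close> tends to \<open>0\<close>.
\<close>
lemma macdonald_wronskian:
  assumes \<alpha>: "Re \<alpha> = - 1 / 2" and y: "0 \<le> y"
  shows "macdonald (- \<alpha>) y * (of_real y powr (\<alpha> + 1) * bessel_clifford (\<alpha> + 1) (of_real y))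
    + macdonald (\<alpha> + 1) y * bessel_clifford \<alpha> (of_real y) = 1" (is "?W y = 1")
proof -
  have re: "0 < Re (- \<alpha>)" "0 < Re (\<alpha> + 1)" using \<alpha> by simp_all
  \<comment> \<open>Here \<open>0 powr (\<alpha> + 1) = 0\<close>, which is also the limit since Re
    (\<alpha> + 1) > 0. What survives is Gamma(\<alpha> + 1) times its reciprocal.\<close>
  have "?W 0 = 1"
  proof -
    have "\<alpha> + 1 \<notin> \<int>\<^sub>\<le>\<^sub>0"
      using re(2) by (auto elim!: nonpos_Ints_cases simp del: plus_complex.simps)
    thus ?thesis
      using re by (simp add: macdonald_0 bessel_clifford_0 Gamma_def rGamma_eq_zero_iff)
  qed
  moreover have "?W y = ?W 0"
  \<comment> \<open>The derivative is computed away from 0; continuity carries the constant to that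
    endpoint.\<close>
  proof (rule has_derivative_zero_unique_strong_interval[where a = 0 and b = y and k = "{0}"])
    have c: "continuous_on {0..y} (macdonald (- \<alpha>))" "continuous_on {0..y} (macdonald (\<alpha> + 1))"
      using re by (auto intro: continuous_on_subset[OF continuous_on_macdonald])
    show "continuous_on {0..y} ?W"
      using \<alpha> by (intro continuous_intros c) auto
    fix x assume "x \<in> {0..y} - {0}"
    hence x: "0 < x" by simp
    let ?B = "\<lambda>\<nu>. bessel_clifford \<nu> (of_real x)" and ?p = "\<lambda>s. complex_of_real x powr s"
    have x0: "complex_of_real x \<noteq> 0" using x by simp
    \<comment> \<open>The derivative has order - \<alpha> - 1; \<open>macdonald_minus\<close> turns
      it into order \<alpha> + 1, so no third integral appears. \<open>Q\<close> works in the same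
      way.\<close>
    have P: "(macdonald (- \<alpha>) has_vector_derivative - (?p (- (\<alpha> + 1)) * macdonald (\<alpha> + 1) x)) (at x within {0..y})"
    proof -
      have "- \<alpha> - 1 = - (\<alpha> + 1)" by simp
      thus ?thesis
        using has_vector_derivative_macdonald[OF re(1) x] macdonald_minus[OF x, of "\<alpha> + 1"]
        by (metis has_vector_derivative_at_within)
    qed
    have Q: "(macdonald (\<alpha> + 1) has_vector_derivative - (?p \<alpha> * macdonald (- \<alpha>) x)) (at x within {0..y})"
      using has_vector_derivative_macdonald[OF re(2) x] macdonald_minus[OF x, of "- \<alpha>"]
      by (metis has_vector_derivative_at_within minus_minus add_diff_cancel_right')
    have R: "((\<lambda>x. of_real x powr (\<alpha> + 1) * bessel_clifford (\<alpha> + 1) (of_real x)) has_vector_derivative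
        ?p \<alpha> * ?B \<alpha>) (at x within {0..y})"
    proof -
      have "((\<lambda>x. of_real x powr (\<alpha> + 1) * bessel_clifford (\<alpha> + 1) (of_real x)) has_vector_derivative
          ?p (\<alpha> + 1) * ?B (\<alpha> + 1 + 1) + (\<alpha> + 1) * ?p (\<alpha> + 1 - 1) * ?B (\<alpha> + 1)) (at x within {0..y})"
        by (intro has_vector_derivative_mult has_vector_derivative_of_real_powr
            has_vector_derivative_bessel_clifford x)
      also have "?p (\<alpha> + 1) * ?B (\<alpha> + 1 + 1) + (\<alpha> + 1) * ?p (\<alpha> + 1 - 1) * ?B (\<alpha> + 1)
          = ?p \<alpha> * (of_real x * ?B (\<alpha> + 2) + (\<alpha> + 1) * ?B (\<alpha> + 1))"
        unfolding powr_plus_1[OF x] by (simp add: algebra_simps)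
      also have "\<dots> = ?p \<alpha> * ?B \<alpha>"
        by (simp only: bessel_clifford_recurrence)
      finally show ?thesis .
    qed
    have inv: "?p (- (\<alpha> + 1)) * ?p (\<alpha> + 1) = 1"
      using x0 by (simp flip: powr_add)
    have "(?W has_vector_derivative
        (macdonald (- \<alpha>) x * (?p \<alpha> * ?B \<alpha>)
          + - (?p (- (\<alpha> + 1)) * macdonald (\<alpha> + 1) x) * (?p (\<alpha> + 1) * ?B (\<alpha> + 1)))
        + (macdonald (\<alpha> + 1) x * ?B (\<alpha> + 1) + - (?p \<alpha> * macdonald (- \<alpha>) x) * ?B \<alpha>))
        (at x within {0..y})"
      by (intro has_vector_derivative_add has_vector_derivative_mult P Q R
          has_vector_derivative_bessel_clifford)
    also have "(macdonald (- \<alpha>) x * (?p \<alpha> * ?B \<alpha>)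
          + - (?p (- (\<alpha> + 1)) * macdonald (\<alpha> + 1) x) * (?p (\<alpha> + 1) * ?B (\<alpha> + 1)))
        + (macdonald (\<alpha> + 1) x * ?B (\<alpha> + 1) + - (?p \<alpha> * macdonald (- \<alpha>) x) * ?B \<alpha>)
      = (1 - ?p (- (\<alpha> + 1)) * ?p (\<alpha> + 1)) * macdonald (\<alpha> + 1) x * ?B (\<alpha> + 1)"
      by (simp add: algebra_simps)
    also have "\<dots> = 0" by (simp only: inv diff_self mult_zero_left)
    finally show "(?W has_derivative (\<lambda>h. 0)) (at x within {0..y})"
      by (simp add: has_vector_derivative_def)
  qed (use y in auto)
  ultimately show ?thesis by simp
qed

text \<open>This is z^(\<alpha> + 1) times a Wronskian of C_\<alpha>(z) and z^(-\<alpha>)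
  C_(-\<alpha>)(z), an entire expression free of branches. Its derivative vanishes by the recurrence
  at orders - \<alpha> - 1 and \<alpha>; its value at 0 is the reflection formula.\<close>

lemma bessel_clifford_wronskian:
  "z * bessel_clifford (- \<alpha>) z * bessel_clifford (\<alpha> + 1) z
      - bessel_clifford (- \<alpha> - 1) z * bessel_clifford \<alpha> z
    = sin (of_real pi * \<alpha>) / of_real pi" (is "?W z = _")
proof -
  have "(?W has_field_derivative 0) (at z within UNIV)" for z
  proof -
    let ?B = "\<lambda>\<nu>. bessel_clifford \<nu> z"
    have "(?W has_field_derivative
        ((z * ?B (- \<alpha> + 1) + 1 * ?B (- \<alpha>)) * ?B (\<alpha> + 1) + z * ?B (- \<alpha>) * ?B (\<alpha> + 1 + 1))
        - (?B (- \<alpha> - 1 + 1) * ?B \<alpha> + ?B (- \<alpha> - 1) * ?B (\<alpha> + 1))) (at z within UNIV)"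
      by (rule derivative_eq_intros has_field_derivative_bessel_clifford refl)+
         (simp add: algebra_simps)
    also have "((z * ?B (- \<alpha> + 1) + 1 * ?B (- \<alpha>)) * ?B (\<alpha> + 1) + z * ?B (- \<alpha>) * ?B (\<alpha> + 1 + 1))
        - (?B (- \<alpha> - 1 + 1) * ?B \<alpha> + ?B (- \<alpha> - 1) * ?B (\<alpha> + 1))
      = (z * ?B (- \<alpha> + 1) - \<alpha> * ?B (- \<alpha>) - ?B (- \<alpha> - 1)) * ?B (\<alpha> + 1)
        + ?B (- \<alpha>) * (z * ?B (\<alpha> + 2) + (\<alpha> + 1) * ?B (\<alpha> + 1) - ?B \<alpha>)"
      by (simp add: algebra_simps)
    also have "\<dots> = 0"
      using bessel_clifford_recurrence[of z "- \<alpha> - 1"] bessel_clifford_recurrence[of z \<alpha>]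
      by (simp add: algebra_simps)
    finally show ?thesis .
  qed
  hence "?W z = ?W 0"
    using has_field_derivative_zero_constant[of UNIV ?W] by (metis UNIV_I convex_UNIV)
  also have "\<dots> = sin (of_real pi * \<alpha>) / of_real pi"
    using rGamma_reflection_complex[of "- \<alpha>"] by (simp add: bessel_clifford_0 algebra_simps)
  finally show ?thesis .
qed

text \<open>Cramer's rule: \<open>macdonald_wronskian\<close> at \<alpha> and at - \<alpha> - 1 is a
  linear system for the two Macdonald integrals, with determinant
  \<open>bessel_clifford_wronskian\<close>.\<close>

lemma macdonald_eq_bessel_clifford:
  assumes \<alpha>: "Re \<alpha> = - 1 / 2" and y: "0 < y"
  shows "sin (of_real pi * \<alpha>) / of_real pi * macdonald (- \<alpha>) y
    = of_real y powr (- \<alpha>) * bessel_clifford (- \<alpha>) (of_real y) - bessel_clifford \<alpha> (of_real y)"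
proof -
  let ?B = "\<lambda>\<nu>. bessel_clifford \<nu> (of_real y)" and ?p = "\<lambda>s. complex_of_real y powr s"
  let ?P = "macdonald (- \<alpha>) y" and ?Q = "macdonald (\<alpha> + 1) y"
  have 1: "?P * (?p (\<alpha> + 1) * ?B (\<alpha> + 1)) + ?Q * ?B \<alpha> = 1"
    using macdonald_wronskian[OF \<alpha>] y by simp
  have 2: "?Q * (?p (- \<alpha>) * ?B (- \<alpha>)) + ?P * ?B (- \<alpha> - 1) = 1"
    using macdonald_wronskian[of "- \<alpha> - 1" y] \<alpha> y by (simp add: algebra_simps)
  have p: "?p (- \<alpha>) * ?p (\<alpha> + 1) = of_real y"
    using y by (simp flip: powr_add)
  have "?P * (?p (- \<alpha>) * ?p (\<alpha> + 1) * ?B (- \<alpha>) * ?B (\<alpha> + 1) - ?B (- \<alpha> - 1) * ?B \<alpha>)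
    = (?P * (?p (\<alpha> + 1) * ?B (\<alpha> + 1)) + ?Q * ?B \<alpha>) * (?p (- \<alpha>) * ?B (- \<alpha>))
      - (?Q * (?p (- \<alpha>) * ?B (- \<alpha>)) + ?P * ?B (- \<alpha> - 1)) * ?B \<alpha>"
    by (simp add: algebra_simps)
  thus ?thesis
    unfolding 1 2 p bessel_clifford_wronskian by (simp add: mult_ac)
qed

section \<open>Laplace and Stieltjes transforms\<close>

lemma
  fixes z :: complex
  assumes z: "0 < Re z" and a: "0 < a"
  shows integrable_Gamma_exp_scaled:
      "integrable lborel (\<lambda>p. exp (z * of_real p - of_real (a * exp p)))"
    and Gamma_exp_integral_scaled:
      "(LBINT p. exp (z * of_real p - of_real (a * exp p))) = of_real a powr (- z) * Gamma z"
proof -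
  let ?f = "\<lambda>p. exp (z * of_real p - of_real (exp p))"
  let ?g = "\<lambda>p. exp (z * of_real p - of_real (a * exp p))"
  have eq: "?f (ln a + 1 * p) = of_real a powr z * ?g p" for p
  proof -
    have "exp (p + ln a) = a * exp p" using a by (simp add: exp_add)
    thus ?thesis using a by (simp add: of_real_powr_eq_exp algebra_simps flip: exp_add)
  qed
  have nz: "complex_of_real a powr z \<noteq> 0" using a by simp
  have "integrable lborel (\<lambda>p. ?f (ln a + 1 * p))"
    by (intro lborel_integrable_real_affine integrable_Gamma_exp z) simp
  hence "integrable lborel (\<lambda>p. inverse (of_real a powr z) * (of_real a powr z * ?g p))"
    unfolding eq by (rule integrable_mult_right)
  moreover have "inverse (of_real a powr z) * (of_real a powr z * ?g p) = ?g p" for p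
    by (simp only: mult.assoc[symmetric] left_inverse[OF nz] mult_1)
  ultimately show "integrable lborel ?g" by (simp only:)
  have "of_real a powr z * (LBINT p. ?g p) = Gamma z"
    using Gamma_exp_integral[OF z] lborel_integral_real_affine[of 1 ?f "ln a"]
    unfolding eq by simp
  thus "(LBINT p. ?g p) = of_real a powr (- z) * Gamma z"
    using nz by (simp add: powr_minus field_simps)
qed

text \<open>Each step multiplies the left side by (Re w + k) / |w + k| \<le> 1. This replaces the
  cancellation of Gamma against \<open>rGamma\<close> when absolute values leave only the real part
  in Gamma.\<close>

lemma norm_rGamma_mult_Gamma_le:
  assumes w: "0 < Re w"
  shows "norm (rGamma (w + of_nat k)) * Gamma (Re w + real k) \<le> norm (rGamma w) * Gamma (Re w)"
proof (induction k)
  case (Suc k)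
  have pos: "0 < Re w + real k" using w by simp
  have le: "Re w + real k \<le> norm (w + of_nat k)"
    using complex_Re_le_cmod[of "w + of_nat k"] by simp
  have "Gamma (Re w + real (Suc k)) = (Re w + real k) * Gamma (Re w + real k)"
    using Gamma_plus1[of "Re w + real k"] pos nonpos_Ints_nonpos[of "Re w + real k"]
    by (auto simp: add_ac)
  hence "norm (rGamma (w + of_nat (Suc k))) * Gamma (Re w + real (Suc k))
      = (Re w + real k) * (norm (rGamma (w + of_nat k + 1)) * Gamma (Re w + real k))"
    by (simp add: add_ac)
  also have "\<dots> \<le> norm (w + of_nat k) * (norm (rGamma (w + of_nat k + 1)) * Gamma (Re w + real k))"
    using Gamma_real_pos[OF pos] by (intro mult_right_mono le) auto
  also have "\<dots> = norm ((w + of_nat k) * rGamma (w + of_nat k + 1)) * Gamma (Re w + real k)"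
    by (simp add: norm_mult)
  also have "\<dots> \<le> norm (rGamma w) * Gamma (Re w)"
    using Suc.IH by (simp only: rGamma_plus1)
  finally show ?case .
qed simp

text \<open>Termwise integration: term k produces Gamma(\<alpha> + k + 1), which cancels its
  coefficient, and s^(-\<alpha> - 1 - k); the series of exp(-1/s) remains.\<close>

lemma laplace_transform_bessel_clifford:
  assumes \<alpha>: "- 1 < Re \<alpha>" and s: "0 < s"
  shows "(LBINT p. exp ((\<alpha> + 1) * of_real p - of_real (s * exp p)) * bessel_clifford \<alpha> (- of_real (exp p)))
    = of_real s powr (- \<alpha> - 1) * exp (- of_real (1 / s))"
proof -
  define c where "c = (\<lambda>k. (-1) ^ k * rGamma (\<alpha> + of_nat k + 1) / fact k :: complex)"
  define e where "e = (\<lambda>z (p :: real). exp (z * of_real p - of_real (s * exp p)) :: complex)"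
  define f where "f = (\<lambda>k p. c k * e (\<alpha> + 1 + of_nat k) p)"
  have re: "0 < Re (\<alpha> + 1 + of_nat k)" for k using \<alpha> by simp
  have f_eq: "f k p = e (\<alpha> + 1) p * (rGamma (\<alpha> + of_nat k + 1) / fact k * (- of_real (exp p)) ^ k)" for k p
  proof -
    have "e (\<alpha> + 1 + of_nat k) p = e (\<alpha> + 1) p * of_real (exp p) ^ k"
      by (simp add: e_def exp_of_real[symmetric] algebra_simps flip: exp_add exp_of_nat_mult)
    thus ?thesis
      unfolding f_def c_def by (subst power_minus) (simp add: mult_ac)
  qed
  have f_suminf: "(\<Sum>k. f k p)
      = exp ((\<alpha> + 1) * of_real p - of_real (s * exp p)) * bessel_clifford \<alpha> (- of_real (exp p))" for p
    unfolding f_eq e_def bessel_clifford_def by (intro suminf_mult summable_bessel_clifford)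
  have f_int: "integrable lborel (f k)" for k
    unfolding f_def e_def by (intro integrable_mult_right integrable_Gamma_exp_scaled re s)
  have f_integral: "(LBINT p. f k p) = of_real s powr (- \<alpha> - 1) * ((- of_real (1 / s)) ^ k /\<^sub>R fact k)" for k
  proof -
    have "\<alpha> + 1 + of_nat k \<notin> \<int>\<^sub>\<le>\<^sub>0"
      using re[of k] by (auto elim!: nonpos_Ints_cases simp del: plus_complex.simps)
    hence g: "rGamma (\<alpha> + of_nat k + 1) * Gamma (\<alpha> + 1 + of_nat k) = 1"
      by (simp add: Gamma_def rGamma_eq_zero_iff add_ac)
    have "(LBINT p. f k p) = c k * (of_real s powr (- (\<alpha> + 1 + of_nat k)) * Gamma (\<alpha> + 1 + of_nat k))"
      unfolding f_def e_def
      using Gamma_exp_integral_scaled[OF re s] by simp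
    also have "of_real s powr (- (\<alpha> + 1 + of_nat k)) = of_real s powr (- \<alpha> - 1) * of_real (1 / s) ^ k"
    proof -
      have "- (\<alpha> + 1 + of_nat k) = (- \<alpha> - 1) - of_nat k" by simp
      thus ?thesis
        using s by (simp only: powr_diff) (simp add: powr_nat' power_divide)
    qed
    also have "c k * (of_real s powr (- \<alpha> - 1) * of_real (1 / s) ^ k * Gamma (\<alpha> + 1 + of_nat k))
      = (rGamma (\<alpha> + of_nat k + 1) * Gamma (\<alpha> + 1 + of_nat k))
        * (of_real s powr (- \<alpha> - 1) * ((-1) ^ k * of_real (1 / s) ^ k / fact k))"
      by (simp add: c_def)
    also have "\<dots> = of_real s powr (- \<alpha> - 1) * ((- of_real (1 / s)) ^ k /\<^sub>R fact k)"
      unfolding g power_minus[of "of_real (1 / s) :: complex"]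
      by (simp add: scaleR_conv_of_real divide_inverse mult_ac)
    finally show ?thesis .
  qed
  \<comment> \<open>Up to a constant the bound is the series of exp(1/s), which justifies exchanging
    sum and integral.\<close>
  have f_norm: "(LBINT p. norm (f k p)) \<le>
      norm (rGamma (\<alpha> + 1)) * Gamma (Re (\<alpha> + 1)) * s powr (- Re \<alpha> - 1) * ((1 / s) ^ k / fact k)" for k
  proof -
    let ?r = "complex_of_real (Re (\<alpha> + 1) + real k)"
    have r: "0 < Re ?r" using re[of k] by simp
    have n: "complex_of_real (norm (f k p)) = of_real (norm (c k)) * exp (?r * of_real p - of_real (s * exp p))" for p
      by (simp add: f_def e_def norm_mult norm_exp flip: exp_of_real)
    have "complex_of_real (LBINT p. norm (f k p))
        = (LBINT p. of_real (norm (c k)) * exp (?r * of_real p - of_real (s * exp p)))"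
      unfolding n[symmetric] by (rule integral_complex_of_real[symmetric])
    also have "\<dots> = of_real (norm (c k)) * (of_real s powr (- ?r) * Gamma ?r)"
      using Gamma_exp_integral_scaled[OF r s] by simp
    also have "\<dots> = of_real (norm (c k) * (s powr (- (Re (\<alpha> + 1) + real k)) * Gamma (Re (\<alpha> + 1) + real k)))"
      by (simp only: Gamma_complex_of_real powr_of_real[OF less_imp_le[OF s]] of_real_minus[symmetric]
          of_real_mult)
    finally have "(LBINT p. norm (f k p))
        = norm (c k) * (s powr (- (Re (\<alpha> + 1) + real k)) * Gamma (Re (\<alpha> + 1) + real k))"
      by (simp only: of_real_eq_iff)
    also have "s powr (- (Re (\<alpha> + 1) + real k)) = s powr (- Re \<alpha> - 1) * (1 / s) ^ k"
    proof -
      have "- (Re (\<alpha> + 1) + real k) = (- Re \<alpha> - 1) - real k" by simp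
      thus ?thesis
        using s by (simp only: powr_diff) (simp add: powr_realpow power_divide)
    qed
    also have "norm (c k) * (s powr (- Re \<alpha> - 1) * (1 / s) ^ k * Gamma (Re (\<alpha> + 1) + real k))
      = (norm (rGamma (\<alpha> + 1 + of_nat k)) * Gamma (Re (\<alpha> + 1) + real k))
        * (s powr (- Re \<alpha> - 1) * ((1 / s) ^ k / fact k))"
      by (simp add: c_def norm_mult norm_divide norm_power add_ac)
    also have "\<dots> \<le> (norm (rGamma (\<alpha> + 1)) * Gamma (Re (\<alpha> + 1)))
        * (s powr (- Re \<alpha> - 1) * ((1 / s) ^ k / fact k))"
      using s re[of 0] by (intro mult_right_mono norm_rGamma_mult_Gamma_le) auto
    finally show ?thesis by (simp only: mult.assoc)
  qed
  have exp_series: "summable (\<lambda>k. (1 / s) ^ k / fact k)"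
    using summable_exp[of "1 / s"] by (simp add: field_simps)
  have "(\<lambda>k. LBINT p. f k p) sums (LBINT p. \<Sum>k. f k p)"
  proof (rule sums_integral[OF f_int])
    show "summable (\<lambda>k. LBINT p. norm (f k p))"
      by (rule summable_comparison_test'[OF summable_mult[OF exp_series], of 0])
         (use f_norm in auto)
    show "AE p in lborel. summable (\<lambda>k. norm (f k p))"
    proof (intro AE_I2)
      fix p
      have "summable (\<lambda>k. norm (rGamma (\<alpha> + of_nat k + 1) / fact k * (- of_real (exp p)) ^ k))"
        \<comment> \<open>Absolute convergence follows from convergence at the point exp p + 1, of
          larger modulus.\<close>
        by (rule powser_insidea[OF summable_bessel_clifford[of \<alpha> "of_real (exp p + 1)"]])
           (simp del: of_real_add)
      thus "summable (\<lambda>k. norm (f k p))"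
        unfolding f_eq norm_mult[of "e (\<alpha> + 1) p"] by (rule summable_mult)
    qed
  qed
  moreover have "(\<lambda>k. LBINT p. f k p) sums (of_real s powr (- \<alpha> - 1) * exp (- of_real (1 / s)))"
    unfolding f_integral by (intro sums_mult exp_converges)
  ultimately show ?thesis
    unfolding f_suminf by (rule sums_unique2)
qed

text \<open>
  Writing \<open>1 / (t + y)\<close> as \<open>\<integral> exp (- (t + y) s) ds\<close> and interchanging the integrals reduces the
  Stieltjes transform of \<open>t\<^sup>\<alpha> C\<^sub>\<alpha> (- t)\<close> to its Laplace transform.
\<close>
lemma
  assumes \<alpha>: "Re \<alpha> = - 1 / 2" and y: "0 < y"
  shows integrable_stieltjes_bessel_clifford:
      "integrable lborel (\<lambda>p. exp ((\<alpha> + 1) * of_real p) * bessel_clifford \<alpha> (- of_real (exp p))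
        / of_real (exp p + y))"
    and stieltjes_bessel_clifford:
      "(LBINT p. exp ((\<alpha> + 1) * of_real p) * bessel_clifford \<alpha> (- of_real (exp p))
        / of_real (exp p + y)) = of_real y powr \<alpha> * macdonald (- \<alpha>) y"
proof -
  define w where "w = (\<lambda>p. exp ((\<alpha> + 1) * of_real p) * bessel_clifford \<alpha> (- of_real (exp p)))"
  \<comment> \<open>With s = exp q the factor exp q is the Jacobian of ds, written
    \<open>1 * of_real q\<close> to match the scaled Gamma integral at z = 1.\<close>
  define H where "H = (\<lambda>q p. w p * exp (1 * of_real q - of_real ((exp p + y) * exp q)))"
  \<comment> \<open>Up to the constant \<open>M\<close>, a positive majorant of \<open>H\<close>,
    with exp(p / 2) in place of \<open>w p\<close>. It is kept complex valued so that the Gamma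
    integrals apply.\<close>
  define H0 where "H0 = (\<lambda>q p :: real. exp (1 / 2 * of_real p - of_real (exp q * exp p))
    * exp (1 * of_real q - of_real (y * exp q)) :: complex)"
  define M where "M = norm (rGamma (\<alpha> + 1))"
  have [measurable]: "w \<in> borel_measurable borel"
    unfolding w_def by (intro borel_measurable_continuous_onI continuous_intros)
  have norm_w: "norm (w p) \<le> M * exp (p / 2)" for p
    using norm_bessel_clifford_minus_le[OF \<alpha>, of "exp p"] \<alpha>
    by (simp add: w_def M_def norm_mult norm_exp mult.commute mult_right_mono)
  have inner: "integrable lborel (\<lambda>p. H0 q p)" for q
    unfolding H0_def by (intro integrable_mult_left integrable_Gamma_exp_scaled) auto
  have "integrable (lborel \<Otimes>\<^sub>M lborel) (\<lambda>(q, p). H0 q p)"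
  proof (rule lborel_pair.Fubini_integrable)
    show "(\<lambda>(q, p). H0 q p) \<in> borel_measurable (lborel \<Otimes>\<^sub>M lborel)"
      unfolding H0_def by measurable
    show "AE q in lborel. integrable lborel (\<lambda>p. case (q, p) of (q, p) \<Rightarrow> H0 q p)"
      using inner by simp
    \<comment> \<open>The p-integral is Gamma(1/2) exp(-q/2); against the Jacobian exp q this leaves
      exp(q/2 - y exp q), integrable because y > 0.\<close>
    have "complex_of_real (LBINT p. norm (H0 q p))
        = Gamma (1 / 2) * exp (1 / 2 * of_real q - of_real (y * exp q))" for q
    proof -
      have "complex_of_real (norm (H0 q p)) = H0 q p" for p
      proof -
        have "H0 q p = of_real (exp (p / 2 - exp q * exp p) * exp (q - y * exp q))"
          by (simp add: H0_def exp_of_real[symmetric])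
        thus ?thesis by (simp only: norm_of_real) simp
      qed
      hence "complex_of_real (LBINT p. norm (H0 q p)) = (LBINT p. H0 q p)"
        by (simp flip: integral_complex_of_real)
      also have "\<dots> = of_real (exp q) powr (- (1 / 2)) * Gamma (1 / 2)
          * exp (1 * of_real q - of_real (y * exp q))"
        unfolding H0_def using Gamma_exp_integral_scaled[of "1 / 2" "exp q"] by simp
      also have "\<dots> = Gamma (1 / 2) * exp (1 / 2 * of_real q - of_real (y * exp q))"
        by (simp add: of_real_powr_eq_exp algebra_simps flip: exp_add)
      finally show ?thesis .
    qed
    hence "integrable lborel (\<lambda>q. complex_of_real (LBINT p. norm (H0 q p)))"
      using y by (simp only:) (intro integrable_mult_right integrable_Gamma_exp_scaled, auto)
    thus "integrable lborel (\<lambda>q. LBINT p. norm (case (q, p) of (q, p) \<Rightarrow> H0 q p))"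
      by (simp add: complex_of_real_integrable_eq)
  qed
  hence "integrable (lborel \<Otimes>\<^sub>M lborel) (\<lambda>x. of_real M * (case x of (q, p) \<Rightarrow> H0 q p))"
    by (rule integrable_mult_right)
  hence H_int: "integrable (lborel \<Otimes>\<^sub>M lborel) (\<lambda>(q, p). H q p)"
  proof (rule Bochner_Integration.integrable_bound)
    show "(\<lambda>(q, p). H q p) \<in> borel_measurable (lborel \<Otimes>\<^sub>M lborel)"
      unfolding H_def by measurable
    have "norm (H q p) \<le> norm (of_real M * H0 q p)" for q p
    proof -
      have "norm (H q p) = norm (w p) * exp (q - (exp p + y) * exp q)"
        by (simp add: H_def norm_mult norm_exp)
      also have "\<dots> \<le> M * exp (p / 2) * exp (q - (exp p + y) * exp q)"
        by (intro mult_right_mono norm_w) auto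
      also have "\<dots> = norm (of_real M * H0 q p)"
        by (simp add: H0_def M_def norm_mult norm_exp algebra_simps flip: exp_add)
      finally show ?thesis .
    qed
    thus "AE x in lborel \<Otimes>\<^sub>M lborel. norm (case x of (q, p) \<Rightarrow> H q p)
        \<le> norm (of_real M * (case x of (q, p) \<Rightarrow> H0 q p))"
      by auto
  qed
  have H_q: "(LBINT q. H q p) = w p / of_real (exp p + y)" for p
  proof -
    have pos: "0 < exp p + y" using y by (simp add: add_pos_pos)
    have "(LBINT q. H q p) = w p * (of_real (exp p + y) powr (- 1) * Gamma 1)"
      unfolding H_def using Gamma_exp_integral_scaled[OF _ pos, of 1] by simp
    thus ?thesis
      using pos by (simp add: powr_minus divide_inverse del: of_real_add)
  qed
  have H_p: "(LBINT p. H q p) = exp (- \<alpha> * of_real q - of_real (exp (- q)) - of_real (y * exp q))" for q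
  proof -
    have "H q p = exp (1 * of_real q - of_real (y * exp q))
        * (exp ((\<alpha> + 1) * of_real p - of_real (exp q * exp p)) * bessel_clifford \<alpha> (- of_real (exp p)))" for p
      by (simp add: H_def w_def algebra_simps exp_diff exp_add)
    hence "(LBINT p. H q p) = exp (1 * of_real q - of_real (y * exp q))
        * (of_real (exp q) powr (- \<alpha> - 1) * exp (- of_real (1 / exp q)))"
      using laplace_transform_bessel_clifford[of \<alpha> "exp q"] \<alpha> by simp
    also have "\<dots> = exp (- \<alpha> * of_real q - of_real (exp (- q)) - of_real (y * exp q))"
    proof -
      have "1 / exp q = exp (- q)" by (simp add: exp_minus divide_inverse)
      thus ?thesis by (simp add: of_real_powr_eq_exp algebra_simps flip: exp_add)
    qed
    finally show ?thesis .
  qed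
  have "integrable lborel (\<lambda>p. LBINT q. H q p)"
    by (rule lborel_pair.integrable_snd[OF H_int])
  thus "integrable lborel (\<lambda>p. exp ((\<alpha> + 1) * of_real p) * bessel_clifford \<alpha> (- of_real (exp p))
        / of_real (exp p + y))"
    by (simp only: H_q w_def)
  have "(LBINT p. w p / of_real (exp p + y)) = (LBINT p. LBINT q. H q p)"
    by (simp only: H_q)
  also have "\<dots> = (LBINT q. LBINT p. H q p)"
    by (rule lborel_pair.Fubini_integral[OF H_int])
  also have "\<dots> = (LBINT q. exp (- \<alpha> * of_real q - of_real (exp (- q)) - of_real (y * exp q)))"
    by (simp only: H_p)
  \<comment> \<open>Translation by - ln y turns y exp q into exp q and exp(-q) into y exp(-q), as in
    Macdonald's integrand, and splits off y^\<alpha>.\<close>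
  also have "\<dots> = (LBINT q. exp (- \<alpha> * of_real (- ln y + q) - of_real (exp (- (- ln y + q)))
      - of_real (y * exp (- ln y + q))))"
    by (subst lborel_integral_real_affine[where c = 1 and t = "- ln y"]) simp_all
  also have "\<dots> = (LBINT q. of_real y powr \<alpha>
      * exp (- \<alpha> * of_real q - of_real (exp q) - of_real (y * exp (- q))))"
  proof (rule Bochner_Integration.integral_cong[OF refl])
    fix q
    have "exp (- (- ln y + q)) = y * exp (- q)" "y * exp (- ln y + q) = exp q"
      using y by (simp_all add: exp_add exp_diff exp_minus field_simps)
    thus "exp (- \<alpha> * of_real (- ln y + q) - of_real (exp (- (- ln y + q)))
        - of_real (y * exp (- ln y + q)))
      = of_real y powr \<alpha> * exp (- \<alpha> * of_real q - of_real (exp q) - of_real (y * exp (- q)))"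
      using y by (simp only: of_real_powr_eq_exp exp_add[symmetric]) (simp add: algebra_simps)
  qed
  also have "\<dots> = of_real y powr \<alpha> * macdonald (- \<alpha>) y"
    by (simp add: macdonald_def)
  finally show "(LBINT p. exp ((\<alpha> + 1) * of_real p) * bessel_clifford \<alpha> (- of_real (exp p))
        / of_real (exp p + y)) = of_real y powr \<alpha> * macdonald (- \<alpha>) y"
    by (simp only: w_def)
qed

section \<open>Return to the Bessel functions\<close>

lemma Bessel_J_eq_bessel_clifford:
  "Bessel_J \<alpha> z = (z / 2) powr \<alpha> * bessel_clifford \<alpha> (- ((z / 2)\<^sup>2))"
proof -
  have "(- ((z / 2)\<^sup>2)) ^ k = (-1) ^ k * (z / 2) ^ (2 * k)" for k
    by (subst power_minus) (simp only: power_mult)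
  thus ?thesis
    unfolding Bessel_J_def bessel_clifford_def by (simp add: mult_ac)
qed

lemma Bessel_I_eq_bessel_clifford:
  "Bessel_I \<alpha> z = (z / 2) powr \<alpha> * bessel_clifford \<alpha> ((z / 2)\<^sup>2)"
  by (simp only: Bessel_I_def bessel_clifford_def power_mult)

theorem corollary4p7:
  fixes l \<mu> x :: real and \<alpha> :: complex and f :: "real \<Rightarrow> complex"
  assumes "l > 0"
    and "\<alpha> = - 1 / 2 - \<i> * complex_of_real \<mu>"
    and "x < 0"
  defines "f \<equiv> \<lambda>t. complex_of_real t powr (\<alpha> / 2) * Bessel_J \<alpha> (complex_of_real (l * sqrt t))
                 / complex_of_real (t - x)"
  shows "set_integrable lborel {0<..} f \<and>
         complex_of_real (1 / pi) * (LBINT t:{0<..}. f t) =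
           complex_of_real (- x) powr (\<alpha> / 2) / complex_of_real (cosh (pi * \<mu>)) *
             (Bessel_I \<alpha> (complex_of_real (l * sqrt (- x)))
              - Bessel_I (- \<alpha>) (complex_of_real (l * sqrt (- x))))"
proof -
  \<comment> \<open>J at l sqrt t involves C_\<alpha>(- b t), so scaling t by b removes l and moves
    the pole from x to b x = - y. \<open>u\<close> is half the argument of I, and \<open>K\<close>
    is the power (l / 2)^(-\<alpha>) left over by the scaling.\<close>
  define b where "b = (l / 2)\<^sup>2"
  define u where "u = l / 2 * sqrt (- x)"
  define y where "y = u\<^sup>2"
  define K where "K = exp (- \<alpha> * of_real (ln (l / 2)))"
  define S where "S = (\<lambda>p. exp ((\<alpha> + 1) * of_real p) * bessel_clifford \<alpha> (- of_real (exp p))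
    / of_real (exp p + y))"
  have re: "Re \<alpha> = - 1 / 2" using assms(2) by simp
  have b: "0 < b" and u: "0 < u" and y: "0 < y"
    using assms(1,3) by (simp_all add: b_def u_def y_def)
  have ln_b: "ln b = 2 * ln (l / 2)"
    unfolding b_def using assms(1) by (subst ln_realpow) auto
  have ln_y: "ln y = 2 * ln u"
    unfolding y_def using u by (subst ln_realpow) auto
  have ln_u: "ln u = ln (l / 2) + ln (- x) / 2"
    unfolding u_def using assms(1,3) by (subst ln_mult) (auto simp: ln_sqrt)
  have y_eq: "y = b * (- x)"
    using assms(3) by (simp add: y_def u_def b_def power_mult_distrib power_divide)
  have integrand: "exp p *\<^sub>R f (exp p) = K * S (ln b + 1 * p)" for p
  proof -
    have half: "complex_of_real (l * sqrt (exp p)) / 2 = of_real (l / 2 * exp (p / 2))"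
    proof -
      have "sqrt (exp p) = exp (p / 2)"
        by (rule real_sqrt_unique) (simp_all flip: exp_double)
      thus ?thesis by simp
    qed
    have sq: "(complex_of_real (l / 2 * exp (p / 2)))\<^sup>2 = of_real (b * exp p)"
    proof -
      have "(l / 2 * exp (p / 2))\<^sup>2 = b * exp p"
        by (simp add: b_def power_mult_distrib power_divide flip: exp_double)
      thus ?thesis by (simp only: of_real_power[symmetric])
    qed
    have pow: "complex_of_real (l / 2 * exp (p / 2)) powr \<alpha> = exp (\<alpha> * of_real (ln (l / 2) + p / 2))"
    proof -
      have "ln (l / 2 * exp (p / 2)) = ln (l / 2) + p / 2"
        using assms(1) by (subst ln_mult) auto
      thus ?thesis
        using of_real_powr_eq_exp[of "l / 2 * exp (p / 2)" \<alpha>] assms(1) by simp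
    qed
    have "f (exp p) = exp (\<alpha> / 2 * of_real p) * (exp (\<alpha> * of_real (ln (l / 2) + p / 2))
        * bessel_clifford \<alpha> (- of_real (b * exp p))) / of_real (exp p - x)"
      unfolding f_def Bessel_J_eq_bessel_clifford half sq pow
      by (simp add: of_real_powr_eq_exp)
    hence "exp p *\<^sub>R f (exp p) = exp (of_real p) * exp (\<alpha> / 2 * of_real p) * exp (\<alpha> * of_real (ln (l / 2) + p / 2))
        * bessel_clifford \<alpha> (- of_real (b * exp p)) / of_real (exp p - x)"
      by (simp add: scaleR_conv_of_real exp_of_real)
    also have "exp (of_real p) * exp (\<alpha> / 2 * of_real p) * exp (\<alpha> * of_real (ln (l / 2) + p / 2))
        = K * exp ((\<alpha> + 1) * of_real (ln b + p)) / of_real b"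
    proof -
      have "complex_of_real b = exp (of_real (ln b))"
        using b by (simp add: exp_of_real)
      thus ?thesis
        by (simp add: K_def ln_b algebra_simps flip: exp_add exp_diff)
    qed
    also have "exp (ln b + p) = b * exp p" using b by (simp add: exp_add)
    hence "K * exp ((\<alpha> + 1) * of_real (ln b + p)) / of_real b * bessel_clifford \<alpha> (- of_real (b * exp p))
        / of_real (exp p - x) = K * S (ln b + 1 * p)"
      using b by (simp add: S_def y_eq right_diff_distrib[symmetric] del: of_real_add of_real_mult of_real_diff)
        (simp add: field_simps)
    finally show ?thesis .
  qed
  have S_int: "integrable lborel S"
    unfolding S_def by (rule integrable_stieltjes_bessel_clifford[OF re y])
  hence int: "integrable lborel (\<lambda>p. exp p *\<^sub>R f (exp p))"
    unfolding integrand by (intro integrable_mult_right lborel_integrable_real_affine) simp_all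
  hence meas: "(\<lambda>p. exp p *\<^sub>R f (exp p)) \<in> borel_measurable borel"
    using borel_measurable_integrable by simp
  from int have f_int: "set_integrable lborel {0<..} f"
    by (simp only: set_integrable_exp_substitution[OF meas])
  have "(LBINT t:{0<..}. f t) = K * (LBINT p. S p)"
    unfolding set_integral_exp_substitution[OF meas f_int] integrand
    by (subst lborel_integral_real_affine[of 1 S "ln b"]) simp_all
  also have "\<dots> = K * of_real y powr \<alpha> * macdonald (- \<alpha>) y"
    unfolding S_def stieltjes_bessel_clifford[OF re y] by simp
  finally have lhs: "(LBINT t:{0<..}. f t) = K * of_real y powr \<alpha> * macdonald (- \<alpha>) y" .
  \<comment> \<open>Both sides are (l / 2)^\<alpha> (-x)^\<alpha>.\<close>
  have K: "K * of_real y powr \<alpha> = of_real (- x) powr (\<alpha> / 2) * of_real u powr \<alpha>"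
    using y u assms(3) unfolding K_def
    by (simp add: of_real_powr_eq_exp ln_y ln_u algebra_simps flip: exp_add del: of_real_minus)
  have u_pow: "of_real u powr \<alpha> * of_real y powr (- \<alpha>) = of_real u powr (- \<alpha>)"
    using y u by (simp add: of_real_powr_eq_exp ln_y algebra_simps flip: exp_add)
  have I: "Bessel_I \<nu> (of_real (l * sqrt (- x))) = of_real u powr \<nu> * bessel_clifford \<nu> (of_real y)" for \<nu>
    unfolding Bessel_I_eq_bessel_clifford by (simp add: u_def y_def)
  \<comment> \<open>Since pi \<alpha> = - (pi / 2 + i pi \<mu>), a quarter period turns the sine
    into a cosine at an imaginary argument.\<close>
  have sin: "sin (of_real pi * \<alpha>) = - of_real (cosh (pi * \<mu>))"
  proof -
    have "of_real pi * \<alpha> = - (of_real (pi / 2) + \<i> * of_real (pi * \<mu>))"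
      by (simp add: assms(2) algebra_simps)
    moreover have "sin (complex_of_real (pi / 2) + z) = cos z" for z
      by (simp only: sin_add sin_of_real cos_of_real sin_pi_half cos_pi_half) simp
    moreover have "cos (\<i> * of_real (pi * \<mu>)) = of_real (cosh (pi * \<mu>))"
      by (simp only: cosh_conv_cos[symmetric]) (simp add: cosh_field_def exp_of_real[symmetric])
    ultimately show ?thesis by (simp only: sin_minus)
  qed
  have cosh: "complex_of_real (cosh (pi * \<mu>)) \<noteq> 0"
    by simp
  have "of_real (cosh (pi * \<mu>)) / of_real pi * macdonald (- \<alpha>) y
      = bessel_clifford \<alpha> (of_real y) - of_real y powr (- \<alpha>) * bessel_clifford (- \<alpha>) (of_real y)"
    using macdonald_eq_bessel_clifford[OF re y] unfolding sin by (simp add: algebra_simps)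
  hence mac: "of_real (1 / pi) * macdonald (- \<alpha>) y = (bessel_clifford \<alpha> (of_real y)
      - of_real y powr (- \<alpha>) * bessel_clifford (- \<alpha>) (of_real y)) / of_real (cosh (pi * \<mu>))"
    using cosh by (simp add: field_simps)
  have "of_real (1 / pi) * (LBINT t:{0<..}. f t)
      = of_real (- x) powr (\<alpha> / 2) * of_real u powr \<alpha> * (of_real (1 / pi) * macdonald (- \<alpha>) y)"
    unfolding lhs K by (simp only: mult_ac)
  hence "of_real (1 / pi) * (LBINT t:{0<..}. f t) = of_real (- x) powr (\<alpha> / 2) / of_real (cosh (pi * \<mu>))
      * (of_real u powr \<alpha> * bessel_clifford \<alpha> (of_real y)
        - of_real u powr \<alpha> * of_real y powr (- \<alpha>) * bessel_clifford (- \<alpha>) (of_real y))"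
    unfolding mac by (simp add: algebra_simps diff_divide_distrib)
  thus ?thesis
    using f_int unfolding I u_pow by blast
qed

end
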